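(* For all integers $m\ge 1$ and $k\ge 2$, the graph $OTIS(BF(2m+1,2k))$ is Hamiltonian.
   Context: All graphs are finite, simple and undirected. For integers $p,q\ge 3$, the (generalized) butterfly/bowtie graph $BF(p,q)$ is the graph consisting of two cycles $C_p$ and $C_q$ (on $p$ and $q$ vertices) sharing exactly one vertex, which is a cutvertex. Explicitly, its vertex set is $\{1,2,\dots,p+q-1\}$; with $c=p$, the vertices $1,2,\dots,c$ form in this cyclic order the cycle $C_p$, and the vertices $c,c+1,\dots,p+q-1$ form in this cyclic order the cycle $C_q$; there are no other edges. For a graph $G$, the graph $OTIS(G)$ has vertex set $\{\langle u,v\rangle : u,v\in V(G)\}$ and edge set $$\{(\langle v,u\rangle,\langle v,u'\rangle) : v\in V(G),\ (u,u')\in E(G)\}\ \cup\ \{(\langle v,u\rangle,\langle u,v\rangle) : u,v\in V(G),\ u\ne v\}.$$ A graph is Hamiltonian if it has a cycle passing through every vertex exactly once. *)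

theory Defs
  imports "Graph_Theory.Graph_Theory"
begin

text \<open>
  A finite simple undirected graph is represented as a \<^locale>\<open>pair_graph\<close>: every
  undirected edge appears as its two opposite arcs.
\<close>

definition cycle_edges :: "nat \<Rightarrow> nat \<Rightarrow> (nat \<times> nat) set" where
  "cycle_edges a b =
     (let R = {(i, Suc i) | i. a \<le> i \<and> i < b} \<union> {(b, a)} in R \<union> R\<inverse>)"

definition BF :: "nat \<Rightarrow> nat \<Rightarrow> nat pair_pre_digraph" where
  "BF p q = \<lparr> pverts = {1..p + q - 1},
              parcs = cycle_edges 1 p \<union> cycle_edges p (p + q - 1) \<rparr>"

definition OTIS :: "'a pair_pre_digraph \<Rightarrow> ('a \<times> 'a) pair_pre_digraph" where
  "OTIS G = \<lparr> pverts = pverts G \<times> pverts G,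
              parcs = {((v, u), (v, u')) | v u u'. v \<in> pverts G \<and> (u, u') \<in> parcs G}
                    \<union> {((v, u), (u, v)) | u v. u \<in> pverts G \<and> v \<in> pverts G \<and> u \<noteq> v} \<rparr>"

text \<open>
  The library's cycles are directed, so traversing one undirected edge back and forth
  counts as a cycle of length 2; the length bound excludes this. The vertices of a cycle
  are exactly the tails of its arcs.
\<close>

definition hamiltonian :: "'a pair_pre_digraph \<Rightarrow> bool" where
  "hamiltonian G \<longleftrightarrow>
     (\<exists>p. pre_digraph.cycle (with_proj G) p \<and> length p \<ge> 3 \<and> fst ` set p = pverts G)"

lemma pair_graphI:
  assumes "finite (pverts G)" "parcs G \<subseteq> pverts G \<times> pverts G"
    and "sym (parcs G)" "irrefl (parcs G)"
  shows "pair_graph G"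
proof -
  have "finite (parcs G)"
    using assms(1,2) by (meson finite_SigmaI finite_subset)
  then show ?thesis
    using assms by unfold_locales (auto simp: symmetric_def irrefl_def)
qed

lemma pair_graph_BF:
  assumes "p \<ge> 3" "q \<ge> 3"
  shows "pair_graph (BF p q)"
  using assms by (intro pair_graphI) (auto simp: BF_def cycle_edges_def sym_def irrefl_def)

lemma pair_graph_OTIS:
  assumes "pair_graph G"
  shows "pair_graph (OTIS G)"
proof -
  interpret pair_graph G by fact
  have "sym (parcs G)"
    using pair_sym_arcs by (simp add: symmetric_def)
  then show ?thesis
    by (intro pair_graphI)
       (auto simp: OTIS_def sym_def irrefl_def dest: wellformed' pair_no_loops)
qed

end

theory Submission
  imports Defs
begin

text \<open>
  Call the copy of \<open>G\<close> consisting of the vertices \<open>(z, _)\<close> the row of \<open>z\<close>. Starting from an explicit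
  Hamiltonian cycle of \<open>OTIS(BF(3,4))\<close>, an edge \<open>w w'\<close> of one of the two cycles that avoids the
  cutvertex is replaced repeatedly by a path \<open>w a b w'\<close>, which lengthens that cycle of the bowtie by 2.
  A Hamiltonian cycle that uses \<open>w w'\<close> in every row is adapted as follows. Let \<open>X\<close> and \<open>y\<close> be
  neighbours of the cutvertex on different cycles, so that the bowtie has a Hamiltonian path from
  \<open>X\<close> to \<open>y\<close>. Every row other than those of \<open>X\<close> and \<open>y\<close> just takes the detour through \<open>a\<close> and \<open>b\<close>.
  In the rows of \<open>X\<close> and \<open>y\<close> the edge \<open>w w'\<close> is removed and the four ends are joined in pairs through
  the new rows of \<open>a\<close> and \<open>b\<close>, both traversed along the Hamiltonian path. The result is a single cycle
  provided that the rows of \<open>X\<close> and \<open>y\<close> were traversing \<open>w w'\<close> in the same direction.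

  To keep this condition alive, one follows three rows \<open>X\<close>, \<open>y1\<close>, \<open>y2\<close> which the cycle meets in this
  order and which traverse \<open>w w'\<close> in alternating directions, \<open>y1\<close> and \<open>y2\<close> being the two neighbours of
  the cutvertex on the cycle without \<open>X\<close>. Splicing at \<open>X\<close> and \<open>y2\<close> recreates the configuration for the
  edge \<open>b w'\<close> with \<open>y1\<close> and \<open>y2\<close> exchanged, and the part of the cycle after it is left intact. A
  second such configuration, for an edge of the other cycle of the bowtie, sits in that part and is
  used once the first cycle is long enough.
\<close>

section \<open>Consecutive elements of a list\<close>

text \<open>Both orientations of a step are recorded, so membership says that a walk uses an edge
  but not in which direction; this makes reversal harmless. Directions are tracked by
  \<open>alternating\<close>.\<close>

fun links :: "'a list \<Rightarrow> ('a \<times> 'a) set" where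
  "links (u # v # r) = {(u, v), (v, u)} \<union> links (v # r)"
| "links _ = {}"

lemma links_Cons: "r \<noteq> [] \<Longrightarrow> links (u # r) = {(u, hd r), (hd r, u)} \<union> links r"
  by (cases r) auto

lemma links_append:
  "xs \<noteq> [] \<Longrightarrow> ys \<noteq> [] \<Longrightarrow>
    links (xs @ ys) = links xs \<union> {(last xs, hd ys), (hd ys, last xs)} \<union> links ys"
  by (induction xs rule: links.induct) (auto simp: links_Cons)

lemma links_append_subset: "links xs \<union> links ys \<subseteq> links (xs @ ys)"
  by (cases "xs = []"; cases "ys = []") (auto simp: links_append)

lemma links_rev [simp]: "links (rev xs) = links xs"
proof (induction xs rule: links.induct)
  case (1 u v r)
  then show ?case
    using links_append[of "rev r @ [v]" "[u]"] by auto
qed auto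

lemma links_map: "links (map f xs) = map_prod f f ` links xs"
  by (induction xs rule: links.induct) auto

lemma links_sym: "(u, v) \<in> links xs \<Longrightarrow> (v, u) \<in> links xs"
  by (induction xs rule: links.induct) auto

lemma links_set: "(u, v) \<in> links xs \<Longrightarrow> u \<in> set xs \<and> v \<in> set xs"
  by (induction xs rule: links.induct) auto

lemma links_split:
  assumes "(u, v) \<in> links xs"
  obtains ys zs where "xs = ys @ u # v # zs \<or> xs = ys @ v # u # zs"
  using assms
proof (induction xs arbitrary: thesis rule: links.induct)
  case (1 x y r)
  show ?case
  proof (cases "(u, v) \<in> links (y # r)")
    case True
    then obtain ys zs where "y # r = ys @ u # v # zs \<or> y # r = ys @ v # u # zs"
      using "1.IH" by blast
    then show ?thesis
      using "1.prems"(1)[of "x # ys" zs] by auto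
  next
    case False
    then show ?thesis
      using "1.prems" by (metis Un_iff append_Nil empty_iff insert_iff links.simps(1) prod.inject)
  qed
qed auto

section \<open>Hamiltonian cycles of OTIS graphs as lists\<close>

text \<open>Adjacency of the OTIS graph without restriction to its vertices; \<open>ham_list\<close>
  imposes that restriction through \<open>set xs\<close>.\<close>

definition otis_rel :: "('a \<times> 'a) set \<Rightarrow> (('a \<times> 'a) \<times> ('a \<times> 'a)) set" where
  "otis_rel E = {((v, u), (v, u')) | v u u'. (u, u') \<in> E} \<union> {((v, u), (u, v)) | u v. u \<noteq> v}"

lemma otis_rel_iff:
  "((v, u), (v', u')) \<in> otis_rel E \<longleftrightarrow> (v' = v \<and> (u, u') \<in> E) \<or> (v' = u \<and> u' = v \<and> u \<noteq> v)"
  by (auto simp: otis_rel_def)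

definition ham_list :: "'a set \<Rightarrow> ('a \<times> 'a) set \<Rightarrow> ('a \<times> 'a) list \<Rightarrow> bool" where
  "ham_list V E xs \<longleftrightarrow> xs \<noteq> [] \<and> distinct xs \<and> set xs = V \<times> V \<and> links xs \<subseteq> otis_rel E
     \<and> (last xs, hd xs) \<in> otis_rel E"

lemma otis_rel_sym: "sym E \<Longrightarrow> sym (otis_rel E)"
  by (auto simp: sym_def otis_rel_def)

lemma ham_list_rotate:
  assumes "ham_list V E (xs @ ys)" "sym E"
  shows "ham_list V E (ys @ xs)"
proof (cases "xs = [] \<or> ys = []")
  case False
  then show ?thesis
    using assms symD[OF otis_rel_sym[OF assms(2)]]
    by (auto simp: ham_list_def links_append Un_commute[of "set ys" "set xs"])
qed (use assms in auto)

section \<open>Subdividing an edge in all rows of a walk\<close>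

context
  fixes w w' a b :: 'a
begin

definition mid :: "'a \<times> 'a \<Rightarrow> 'a \<times> 'a \<Rightarrow> ('a \<times> 'a) list" where
  "mid u v =
    (if fst u = fst v \<and> snd u = w \<and> snd v = w' then [(fst u, a), (fst u, b)]
     else if fst u = fst v \<and> snd u = w' \<and> snd v = w then [(fst u, b), (fst u, a)] else [])"

text \<open>Only steps inside the list are refined. The closing step from the last element to the
  first is left alone and is treated separately in \<open>ham_list_splice\<close>.\<close>

fun subdiv :: "('a \<times> 'a) list \<Rightarrow> ('a \<times> 'a) list" where
  "subdiv (u # v # r) = u # mid u v @ subdiv (v # r)"
| "subdiv xs = xs"

lemma subdiv_eq_Nil [simp]: "subdiv xs = [] \<longleftrightarrow> xs = []"
  by (induction xs rule: subdiv.induct) auto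

lemma hd_subdiv [simp]: "hd (subdiv xs) = hd xs"
  by (induction xs rule: subdiv.induct) auto

lemma last_subdiv [simp]: "last (subdiv xs) = last xs"
  by (induction xs rule: subdiv.induct) (auto simp: last_append)

lemma subdiv_append:
  "xs \<noteq> [] \<Longrightarrow> ys \<noteq> [] \<Longrightarrow> subdiv (xs @ ys) = subdiv xs @ mid (last xs) (hd ys) @ subdiv ys"
proof (induction xs rule: subdiv.induct)
  case ("2_2" v)
  then show ?case by (cases ys) auto
qed auto

lemma set_subdiv:
  assumes "w \<noteq> w'"
  shows "set (subdiv xs) = set xs \<union> {z. ((z, w), (z, w')) \<in> links xs} \<times> {a, b}"
  using assms
proof (induction xs rule: subdiv.induct)
  case (1 u v r)
  have "set (mid u v) = {z. ((z, w), (z, w')) \<in> {(u, v), (v, u)}} \<times> {a, b}"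
    by (cases u; cases v) (auto simp: mid_def)
  then show ?case
    using 1 by auto
qed auto

text \<open>In a distinct list a row runs along \<open>w w'\<close> at most once, because a second
  such step would revisit an end of the first. So no row receives \<open>a\<close> and
  \<open>b\<close> twice.\<close>

lemma distinct_subdiv:
  assumes "distinct xs" "w \<noteq> w'" "a \<noteq> b" "\<And>z. (z, a) \<notin> set xs" "\<And>z. (z, b) \<notin> set xs"
  shows "distinct (subdiv xs)"
  using assms
proof (induction xs rule: subdiv.induct)
  case (1 u v r)
  have *: "set (mid u v) \<inter> set (subdiv (v # r)) = {}"
  proof (rule ccontr)
    assume "set (mid u v) \<inter> set (subdiv (v # r)) \<noteq> {}"
    then obtain p where p: "p \<in> set (mid u v)" "p \<in> set (subdiv (v # r))"
      by blast
    then have "snd p \<in> {a, b}" and u: "u = (fst p, w) \<or> u = (fst p, w')"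
      by (cases u; cases v; auto simp: mid_def split: if_splits)+
    then have "((fst p, w), (fst p, w')) \<in> links (v # r)"
      using p(2) "1.prems"(4,5) \<open>w \<noteq> w'\<close> unfolding set_subdiv[OF \<open>w \<noteq> w'\<close>]
      by (cases p) auto
    then show False
      using u "1.prems"(1) links_set by fastforce
  qed
  have "u \<notin> set (mid u v)"
    using "1.prems"(4,5) by (cases u) (auto simp: mid_def split: if_splits)
  moreover have "u \<notin> set (subdiv (v # r))"
    using "1.prems" unfolding set_subdiv[OF \<open>w \<noteq> w'\<close>] by (cases u) auto
  moreover have "distinct (mid u v)"
    using \<open>a \<noteq> b\<close> by (auto simp: mid_def)
  ultimately show ?case
    using 1 * by auto
qed auto

text \<open>The edge \<open>b w'\<close> is the one that the next extension subdivides, so it has to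
  occur in every row.\<close>

lemma links_subdiv_new:
  assumes "((z, w), (z, w')) \<in> links xs" "w \<noteq> w'"
  shows "{((z, w), (z, a)), ((z, b), (z, w'))} \<subseteq> links (subdiv xs)"
  using assms
proof (induction xs rule: subdiv.induct)
  case (1 u v r)
  have sub: "links (subdiv (v # r)) \<subseteq> links (subdiv (u # v # r))"
    using links_append_subset[of "u # mid u v" "subdiv (v # r)"] by auto
  show ?case
  proof (cases "((z, w), (z, w')) \<in> links (v # r)")
    case True
    then show ?thesis
      using 1 sub by blast
  next
    case False
    then consider "u = (z, w)" "v = (z, w')" | "u = (z, w')" "v = (z, w)"
      using "1.prems" by auto
    then show ?thesis
      by cases (use \<open>w \<noteq> w'\<close> in \<open>auto simp: mid_def links_Cons\<close>)
  qed
qed auto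

lemma links_subdiv_keep:
  assumes "((z, x), (z', x')) \<in> links xs" "(x, x') \<noteq> (w, w')" "(x, x') \<noteq> (w', w)"
  shows "((z, x), (z', x')) \<in> links (subdiv xs)"
  using assms
proof (induction xs rule: subdiv.induct)
  case (1 u v r)
  have sub: "links (subdiv (v # r)) \<subseteq> links (subdiv (u # v # r))"
    using links_append_subset[of "u # mid u v" "subdiv (v # r)"] by auto
  show ?case
  proof (cases "((z, x), (z', x')) \<in> links (v # r)")
    case True
    then show ?thesis
      using 1 sub by blast
  next
    case False
    then have *: "(u, v) = ((z, x), (z', x')) \<or> (v, u) = ((z, x), (z', x'))"
      using "1.prems" by auto
    then have "mid u v = []"
      using "1.prems" by (auto simp: mid_def)
    then show ?thesis
      using * by (auto simp: links_Cons)
  qed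
qed auto

text \<open>Transposition steps survive any change of the edge set, so only steps inside a row
  matter. Those along \<open>w w'\<close> are rerouted through \<open>a\<close> and
  \<open>b\<close>; all others use an edge that remains in \<open>E'\<close>.\<close>

lemma links_subdiv_subset:
  assumes "links xs \<subseteq> otis_rel E"
    and "E - {(w, w'), (w', w)} \<union> links [w, a, b, w'] \<subseteq> E'" "w \<noteq> w'"
  shows "links (subdiv xs) \<subseteq> otis_rel E'"
  using assms(1)
proof (induction xs rule: subdiv.induct)
  case (1 u v r)
  have IH: "links (subdiv (v # r)) \<subseteq> otis_rel E'"
    using 1 by auto
  obtain z x z' x' where u: "u = (z, x)" and v: "v = (z', x')"
    by fastforce
  have uv: "(u, v) \<in> otis_rel E" "(v, u) \<in> otis_rel E"
    using "1.prems" by auto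
  show ?case
  proof (cases "mid u v = []")
    case True
    then have "(u, v) \<in> otis_rel E' \<and> (v, u) \<in> otis_rel E'"
      using uv assms(2) unfolding u v by (fastforce simp: otis_rel_iff mid_def split: if_splits)
    then show ?thesis
      using IH True by (auto simp: links_Cons)
  next
    case False
    then have "z = z' \<and> (x = w \<and> x' = w' \<or> x = w' \<and> x' = w)"
      unfolding u v by (auto simp: mid_def split: if_splits)
    then show ?thesis
      using IH assms(2,3) unfolding u v by (auto simp: links_Cons mid_def otis_rel_iff)
  qed
qed auto

lemma subdiv_split_keep:
  assumes "mid u v = []"
  shows "subdiv (xs @ u # v # ys) = subdiv (xs @ [u]) @ subdiv (v # ys)"
  using assms subdiv_append[of "xs @ [u]" "v # ys"] by simp

lemma subdiv_ConsE:
  obtains zs where "subdiv (u # xs) = u # zs"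
  by (cases xs) auto

lemma subdiv_snocE:
  obtains zs where "subdiv (xs @ [u]) = zs @ [u]"
proof -
  have "subdiv (xs @ [u]) \<noteq> []" "last (subdiv (xs @ [u])) = u"
    by simp_all
  then show ?thesis
    using that by (metis append_butlast_last_id)
qed

lemma subdiv_endsE:
  obtains zs where "subdiv (u # xs @ [v]) = u # zs @ [v]"
proof -
  obtain zs where "subdiv (u # xs) = u # zs"
    by (rule subdiv_ConsE)
  then show ?thesis
    using subdiv_append[of "u # xs" "[v]"] that by auto
qed

end

section \<open>Splicing in the two rows of the new vertices\<close>

text \<open>Deleting \<open>w w'\<close> in the rows of \<open>X\<close> and \<open>y\<close> leaves
  \<open>S1\<close>, from \<open>(X, w)\<close> to \<open>(y, w')\<close>, and \<open>S2\<close>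
  closed up with \<open>(X, w')\<close>. The row of \<open>b\<close> joins the two ends at
  \<open>w'\<close> and the row of \<open>a\<close> the two ends at \<open>w\<close>, so
  \<open>S1\<close> is run backwards. Had the two rows been traversed in opposite directions, each
  piece would be closed up on its own.\<close>

lemma ham_list_splice:
  assumes ham: "ham_list V E ((X, w') # S1 @ S2)"
    and S1: "S1 \<noteq> []" "hd S1 = (X, w)" "last S1 = (y, w')"
    and S2: "S2 \<noteq> []" "hd S2 = (y, w)"
    and rows: "\<forall>z \<in> V. ((z, w), (z, w')) \<in> links ((X, w') # S1 @ S2)"
    and new: "a \<notin> V" "b \<notin> V" "a \<noteq> b"
    and E': "E - {(w, w'), (w', w)} \<union> links [w, a, b, w'] \<subseteq> E'"
    and \<rho>: "\<rho> \<noteq> []" "hd \<rho> = X" "last \<rho> = y" "distinct \<rho>" "set \<rho> = insert a (insert b V)"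
      "links \<rho> \<subseteq> E'"
    and xs': "xs' = [(X, w'), (X, b)] @ map (Pair b) \<rho> @ [(y, b)] @ rev (subdiv w w' a b S1)
      @ [(X, a)] @ map (Pair a) \<rho> @ [(y, a)] @ subdiv w w' a b S2"
  shows "ham_list (insert a (insert b V)) E' xs'"
    and "\<And>z. z \<in> V \<Longrightarrow> ((z, b), (z, w')) \<in> links xs'"
    and "\<And>z g g'. ((z, g), (z, g')) \<in> links ((X, w') # S1 @ S2) \<Longrightarrow> {g, g'} \<inter> {w, w'} = {} \<Longrightarrow>
      ((z, g), (z, g')) \<in> links xs'"
    and "\<And>z g g'. z \<in> {a, b} \<Longrightarrow> (g, g') \<in> links \<rho> \<Longrightarrow> ((z, g), (z, g')) \<in> links xs'"
proof -
  let ?xs = "(X, w') # S1 @ S2" and ?T1 = "subdiv w w' a b S1" and ?T2 = "subdiv w w' a b S2"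
  have mem: "(X, w) \<in> set S1" "(y, w') \<in> set S1" "(y, w) \<in> set S2"
    using S1 S2 hd_in_set last_in_set by metis+
  have dist: "distinct ?xs" and V: "set ?xs = V \<times> V"
    using ham by (simp_all only: ham_list_def)
  have "{(X, w'), (X, w), (y, w'), (y, w)} \<subseteq> V \<times> V"
    using mem unfolding V[symmetric] by auto
  then have inV: "X \<in> V" "y \<in> V" "w \<in> V" "w' \<in> V"
    by auto
  have ww: "w \<noteq> w'" and Xy: "X \<noteq> y"
    using mem dist by auto
  have links: "links ?xs = {((X, w'), (X, w)), ((X, w), (X, w'))} \<union> links S1
      \<union> {((y, w'), (y, w)), ((y, w), (y, w'))} \<union> links S2"
    using S1 S2 by (auto simp: links_Cons links_append)
  have links': "links xs' = {((X, w'), (X, b)), ((X, b), (X, w')), ((X, b), (b, X)), ((b, X), (X, b))}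
      \<union> links (map (Pair b) \<rho>) \<union> {((b, y), (y, b)), ((y, b), (b, y)), ((y, b), (y, w')), ((y, w'), (y, b))}
      \<union> links ?T1 \<union> {((X, w), (X, a)), ((X, a), (X, w)), ((X, a), (a, X)), ((a, X), (X, a))}
      \<union> links (map (Pair a) \<rho>) \<union> {((a, y), (y, a)), ((y, a), (a, y)), ((y, a), (y, w)), ((y, w), (y, a))}
      \<union> links ?T2"
    using S1 S2 \<rho>(1-3) unfolding xs'
    by (simp add: links_Cons links_append hd_map last_map hd_rev last_rev insert_commute Un_ac)
  have subT: "links ?T1 \<subseteq> links xs'" "links ?T2 \<subseteq> links xs'"
    unfolding links' by (rule le_supI1, rule le_supI1, rule le_supI1, rule le_supI1, rule Un_upper2, rule Un_upper2)
  have old: "(z, c) \<notin> set S1" "(z, c) \<notin> set S2" "(c, z) \<notin> set S1" "(c, z) \<notin> set S2"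
    if "c \<in> {a, b}" for z c
    using that V new by auto
  have sep: "set S1 \<inter> set S2 = {}" "distinct S1" "distinct S2"
    using dist by auto
  \<comment> \<open>The steps along \<open>w w'\<close> in the rows of \<open>X\<close> and
    \<open>y\<close> lie exactly at the cuts. Hence \<open>subdiv\<close> serves all other old rows,
    and \<open>xs'\<close> lists the missing vertices of these two explicitly.\<close>
  have rows1: "{z. ((z, w), (z, w')) \<in> links S1} \<union> {z. ((z, w), (z, w')) \<in> links S2} = V - {X, y}"
  proof
    have "z \<in> V - {X, y}" if "((z, w), (z, w')) \<in> links S1 \<or> ((z, w), (z, w')) \<in> links S2" for z
    proof -
      have zz: "(z, w) \<in> set S1 \<and> (z, w') \<in> set S1 \<or> (z, w) \<in> set S2 \<and> (z, w') \<in> set S2"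
        using that links_set by fast
      then have "z \<in> V"
        using V by auto
      moreover have "z \<noteq> X"
        using zz dist by auto
      moreover have "z \<noteq> y"
        using zz sep(1) mem by auto
      ultimately show ?thesis
        by blast
    qed
    then show "{z. ((z, w), (z, w')) \<in> links S1} \<union> {z. ((z, w), (z, w')) \<in> links S2} \<subseteq> V - {X, y}"
      by blast
    show "V - {X, y} \<subseteq> {z. ((z, w), (z, w')) \<in> links S1} \<union> {z. ((z, w), (z, w')) \<in> links S2}"
      using rows unfolding links by auto
  qed
  have rows_disj: "{z. ((z, w), (z, w')) \<in> links S1} \<inter> {z. ((z, w), (z, w')) \<in> links S2} = {}"
    using links_set sep(1) by fast
  have T1: "set ?T1 = set S1 \<union> {z. ((z, w), (z, w')) \<in> links S1} \<times> {a, b}"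
    and T2: "set ?T2 = set S2 \<union> {z. ((z, w), (z, w')) \<in> links S2} \<times> {a, b}"
    by (rule set_subdiv[OF ww])+
  have T12: "set ?T1 \<union> set ?T2 = set S1 \<union> set S2 \<union> (V - {X, y}) \<times> {a, b}"
    unfolding T1 T2 rows1[symmetric] by blast
  have T12_disj: "set ?T1 \<inter> set ?T2 = {}"
    unfolding T1 T2 using rows_disj sep(1) old by auto
  have dT: "distinct ?T1" "distinct ?T2"
    by (rule distinct_subdiv[OF _ ww new(3)]; use sep old in auto)+
  have notin: "p \<notin> set ?T1 \<and> p \<notin> set ?T2"
    if "p \<in> {(X, w')} \<union> {X, y} \<times> {a, b} \<union> {a, b} \<times> UNIV" for p
  proof -
    have "p \<notin> set S1 \<union> set S2 \<union> (V - {X, y}) \<times> {a, b}"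
      using that old dist inV new by auto
    then show ?thesis
      unfolding T12[symmetric] by blast
  qed
  have set': "set xs' = {(X, w')} \<union> {X, y} \<times> {a, b} \<union> {a, b} \<times> insert a (insert b V) \<union> (set ?T1 \<union> set ?T2)"
    unfolding xs' using \<rho>(5) by auto
  have "set xs' = insert a (insert b V) \<times> insert a (insert b V)"
  proof -
    have "{(X, w')} \<union> (set S1 \<union> set S2) = V \<times> V"
      using V by simp
    moreover have "{X, y} \<times> {a, b} \<union> (V - {X, y}) \<times> {a, b} = V \<times> {a, b}"
      using inV by blast
    ultimately have "set xs' = V \<times> V \<union> V \<times> {a, b} \<union> {a, b} \<times> insert a (insert b V)"
      unfolding set' T12 by blast
    then show ?thesis
      by auto
  qed
  moreover have "distinct xs'"
    unfolding xs' using notin dT T12_disj \<rho>(4,5) inV new Xy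
    by (auto simp: distinct_map inj_on_def)
  moreover have "links xs' \<subseteq> otis_rel E'"
  proof -
    have "links ?T1 \<subseteq> otis_rel E'" "links ?T2 \<subseteq> otis_rel E'"
      using ham links E' ww by (intro links_subdiv_subset[where E = E]; auto simp: ham_list_def)+
    moreover have "links (map (Pair c) \<rho>) \<subseteq> otis_rel E'" for c
      using \<rho>(6) by (auto simp: links_map otis_rel_iff)
    ultimately show ?thesis
      unfolding links' using E' inV new by (auto simp: otis_rel_iff)
  qed
  \<comment> \<open>The closing edge could be lost only by being \<open>w w'\<close> in the row of
    \<open>X\<close>, but \<open>(X, w)\<close> already occurs in \<open>S1\<close>.\<close>
  moreover have "(last xs', hd xs') \<in> otis_rel E'"
  proof -
    obtain z u where l: "last S2 = (z, u)"
      by fastforce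
    have "(last S2, (X, w')) \<in> otis_rel E"
      using ham S2 by (simp add: ham_list_def)
    moreover have "(z, u) \<noteq> (X, w)" "(z, u) \<noteq> (X, w')"
      using l dist mem S2 last_in_set[of S2] by auto
    ultimately have "(last S2, (X, w')) \<in> otis_rel E'"
      using E' unfolding l otis_rel_iff by auto
    then show ?thesis
      using S2 by (simp add: xs')
  qed
  ultimately show "ham_list (insert a (insert b V)) E' xs'"
    by (auto simp: ham_list_def xs')
  show "((z, b), (z, w')) \<in> links xs'" if "z \<in> V" for z
  proof (cases "z = X \<or> z = y")
    case False
    then have "((z, w), (z, w')) \<in> links S1 \<or> ((z, w), (z, w')) \<in> links S2"
      using that rows1 by blast
    then have "((z, b), (z, w')) \<in> links ?T1 \<or> ((z, b), (z, w')) \<in> links ?T2"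
      using links_subdiv_new[OF _ ww] by (metis insert_subset)
    then show ?thesis
      using subT by (metis subsetD)
  qed (auto simp: links')
  show "((z, g), (z, g')) \<in> links xs'"
    if "((z, g), (z, g')) \<in> links ?xs" "{g, g'} \<inter> {w, w'} = {}" for z g g'
  proof -
    have "((z, g), (z, g')) \<in> links S1 \<or> ((z, g), (z, g')) \<in> links S2"
      using that unfolding links by auto
    then have "((z, g), (z, g')) \<in> links ?T1 \<or> ((z, g), (z, g')) \<in> links ?T2"
      using that(2) by (auto intro!: links_subdiv_keep)
    then show ?thesis
      using subT by (metis subsetD)
  qed
  show "((z, g), (z, g')) \<in> links xs'" if "z \<in> {a, b}" "(g, g') \<in> links \<rho>" for z g g'
  proof -
    have "((z, g), (z, g')) \<in> links (map (Pair z) \<rho>)"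
      using that(2) by (force simp: links_map)
    then show ?thesis
      using that(1) unfolding links' by auto
  qed
qed

section \<open>Alternating traversals\<close>

text \<open>The remainder \<open>R\<close> is a parameter, unlike \<open>P\<close> and
  \<open>Q\<close>, because a second configuration may be stored in it and has to survive the
  splicing.\<close>

definition alternating ::
  "'a \<Rightarrow> 'a \<Rightarrow> 'a \<Rightarrow> 'a \<Rightarrow> 'a \<Rightarrow> ('a \<times> 'a) list \<Rightarrow> ('a \<times> 'a) list \<Rightarrow> bool" where
  "alternating X y1 y2 w w' R xs \<longleftrightarrow>
    (\<exists>P Q. xs = (X, w') # (X, w) # P @ (y1, w) # (y1, w') # Q @ (y2, w') # (y2, w) # R)"

definition alternating_in ::
  "'a \<Rightarrow> 'a \<Rightarrow> 'a \<Rightarrow> 'a \<Rightarrow> 'a \<Rightarrow> ('a \<times> 'a) list \<Rightarrow> bool" where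
  "alternating_in X y1 y2 w w' zs \<longleftrightarrow> (\<exists>xs ys R. zs = xs @ ys \<and> alternating X y1 y2 w w' R ys)"

lemma alternating_in_append: "alternating_in X y1 y2 g g' zs \<Longrightarrow> alternating_in X y1 y2 g g' (xs @ zs)"
  unfolding alternating_in_def by (metis append.assoc)

text \<open>Steps along \<open>g g'\<close> receive no new vertices, so the list can be cut inside
  each of the three and the four pieces subdivided separately, keeping their ends.\<close>

lemma alternating_in_subdiv:
  assumes "alternating_in X y1 y2 g g' zs" "{g, g'} \<inter> {w, w'} = {}"
  shows "alternating_in X y1 y2 g g' (subdiv w w' a b zs)"
proof -
  let ?s = "subdiv w w' a b"
  obtain R0 P Q R where zs: "zs = R0 @ (X, g') # (X, g) # P @ (y1, g) # (y1, g') # Q @ (y2, g') # (y2, g) # R"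
    using assms(1) by (auto simp: alternating_in_def alternating_def)
  have mid: "mid w w' a b (z, g) (z, g') = []" "mid w w' a b (z, g') (z, g) = []" for z
    using assms(2) by (auto simp: mid_def)
  have "?s zs = ?s (R0 @ [(X, g')]) @ ?s ((X, g) # P @ [(y1, g)]) @ ?s ((y1, g') # Q @ [(y2, g')]) @ ?s ((y2, g) # R)"
    unfolding zs
    using subdiv_split_keep[OF mid(2), of R0 X]
      subdiv_split_keep[OF mid(1), of "(X, g) # P" y1]
      subdiv_split_keep[OF mid(2), of "(y1, g') # Q" y2 R]
    by simp
  moreover obtain A where "?s (R0 @ [(X, g')]) = A @ [(X, g')]"
    by (rule subdiv_snocE)
  moreover obtain B where "?s ((X, g) # P @ [(y1, g)]) = (X, g) # B @ [(y1, g)]"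
    by (rule subdiv_endsE)
  moreover obtain C where "?s ((y1, g') # Q @ [(y2, g')]) = (y1, g') # C @ [(y2, g')]"
    by (rule subdiv_endsE)
  moreover obtain D where "?s ((y2, g) # R) = (y2, g) # D"
    by (rule subdiv_ConsE)
  ultimately have "?s zs = A @ (X, g') # (X, g) # B @ (y1, g) # (y1, g') # C @ (y2, g') # (y2, g) # D"
    by simp
  then show ?thesis
    unfolding alternating_in_def alternating_def by blast
qed

text \<open>The path through the row of \<open>b\<close> is entered from \<open>(X, w')\<close> via
  \<open>(X, b)\<close> and left via \<open>(y2, b)\<close> to \<open>(y2, w')\<close>, which gives
  the first two traversals of \<open>b w'\<close>. The third comes from the row of
  \<open>y1\<close>: its step became \<open>w a b w'\<close> and lies in the reversed
  \<open>S1\<close>, so it now runs from \<open>w'\<close> to \<open>b\<close>.\<close>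

lemma ham_list_step:
  assumes ham: "ham_list V E xs" and alt: "alternating X y1 y2 w w' R xs"
    and rows: "\<forall>z \<in> V. ((z, w), (z, w')) \<in> links xs"
    and new: "a \<notin> V" "b \<notin> V" "a \<noteq> b"
    and E': "E - {(w, w'), (w', w)} \<union> links [w, a, b, w'] \<subseteq> E'"
    and \<rho>: "\<rho> \<noteq> []" "hd \<rho> = X" "last \<rho> = y2" "distinct \<rho>" "set \<rho> = insert a (insert b V)"
      "links \<rho> \<subseteq> E'" "(b, w') \<in> links \<rho>"
  obtains xs' R' where "ham_list (insert a (insert b V)) E' xs'" "alternating X y2 y1 b w' R' xs'"
    "\<And>z. z \<in> insert a (insert b V) \<Longrightarrow> ((z, b), (z, w')) \<in> links xs'"
    "\<And>z g g'. {g, g'} \<inter> {w, w'} = {} \<Longrightarrow> (g, g') \<in> links \<rho> \<Longrightarrow> z \<in> insert a (insert b V) \<Longrightarrow>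
      z \<in> V \<longrightarrow> ((z, g), (z, g')) \<in> links xs \<Longrightarrow> ((z, g), (z, g')) \<in> links xs'"
    "\<And>X' y y' g g'. {g, g'} \<inter> {w, w'} = {} \<Longrightarrow> alternating_in X' y y' g g' R \<Longrightarrow>
      alternating_in X' y y' g g' R'"
proof -
  obtain P Q where xs: "xs = (X, w') # (X, w) # P @ (y1, w) # (y1, w') # Q @ (y2, w') # (y2, w) # R"
    using alt by (auto simp: alternating_def)
  define S1 where "S1 = (X, w) # P @ (y1, w) # (y1, w') # Q @ [(y2, w')]"
  define S2 where "S2 = (y2, w) # R"
  have xs_S: "xs = (X, w') # S1 @ S2"
    by (simp add: xs S1_def S2_def)
  let ?s = "subdiv w w' a b"
  define xs' where "xs' = [(X, w'), (X, b)] @ map (Pair b) \<rho> @ [(y2, b)] @ rev (?s S1)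
      @ [(X, a)] @ map (Pair a) \<rho> @ [(y2, a)] @ ?s S2"
  have S: "S1 \<noteq> []" "hd S1 = (X, w)" "last S1 = (y2, w')" "S2 \<noteq> []" "hd S2 = (y2, w)"
    by (simp_all add: S1_def S2_def)
  note splice = ham_list_splice[OF ham[unfolded xs_S] S rows[unfolded xs_S] new E' \<rho>(1-6) xs'_def, folded xs_S]
  have "w \<noteq> w'"
    using ham by (auto simp: ham_list_def xs)
  have S1_split: "S1 = ((X, w) # P @ [(y1, w)]) @ ((y1, w') # Q @ [(y2, w')])"
    by (simp add: S1_def)
  have "?s S1 = ?s ((X, w) # P @ [(y1, w)]) @ [(y1, a), (y1, b)] @ ?s ((y1, w') # Q @ [(y2, w')])"
    unfolding S1_split by (subst subdiv_append) (simp_all add: mid_def)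
  moreover obtain B where B: "?s ((X, w) # P @ [(y1, w)]) = (X, w) # B @ [(y1, w)]"
    by (rule subdiv_endsE)
  moreover obtain C where C: "?s ((y1, w') # Q @ [(y2, w')]) = (y1, w') # C @ [(y2, w')]"
    by (rule subdiv_endsE)
  ultimately have S1': "rev (?s S1) = (y2, w') # rev C @ [(y1, w'), (y1, b), (y1, a), (y1, w)] @ rev B @ [(X, w)]"
    by simp
  \<comment> \<open>Everything after the step from \<open>(y1, w')\<close> to
    \<open>(y1, b)\<close>. The subdivided \<open>S2\<close>, and with it any configuration stored
    in \<open>R\<close>, sits at its end.\<close>
  define R' where "R' = ([(y1, a), (y1, w)] @ rev B @ [(X, w)]
      @ [(X, a)] @ map (Pair a) \<rho> @ [(y2, a)]) @ ?s S2"
  show ?thesis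
  proof (rule that[of xs' R'])
    show "ham_list (insert a (insert b V)) E' xs'"
      by (rule splice(1))
    show "alternating X y2 y1 b w' R' xs'"
      unfolding alternating_def xs'_def S1' R'_def by force
  next
    fix z
    assume "z \<in> insert a (insert b V)"
    then show "((z, b), (z, w')) \<in> links xs'"
      using splice(2)[of z] splice(4)[OF _ \<rho>(7), of z] by blast
  next
    fix z g g'
    assume "{g, g'} \<inter> {w, w'} = {}" "(g, g') \<in> links \<rho>" "z \<in> insert a (insert b V)"
      "z \<in> V \<longrightarrow> ((z, g), (z, g')) \<in> links xs"
    then show "((z, g), (z, g')) \<in> links xs'"
      using splice(3)[of z g g'] splice(4)[of z g g'] by blast
  next
    fix X' y y' g g'
    assume *: "{g, g'} \<inter> {w, w'} = {}" "alternating_in X' y y' g g' R"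
    show "alternating_in X' y y' g g' R'"
      unfolding R'_def S2_def
      using alternating_in_append[OF *(2), of "[(y2, w)]"] *(1)
      by (intro alternating_in_append alternating_in_subdiv) auto
  qed
qed

section \<open>Bowties given by two lists\<close>

definition bowtie :: "'a \<Rightarrow> 'a list \<Rightarrow> 'a list \<Rightarrow> ('a \<times> 'a) set" where
  "bowtie c us vs = links (c # us @ [c]) \<union> links (c # vs @ [c])"

lemma sym_bowtie: "sym (bowtie c us vs)"
  by (auto simp: sym_def bowtie_def dest: links_sym)

lemma links_closed_path:
  "us \<noteq> [] \<Longrightarrow> links (c # us @ [c]) = {(c, hd us), (hd us, c), (c, last us), (last us, c)} \<union> links us"
  by (auto simp: links_Cons links_append)

text \<open>Run through \<open>us\<close> starting at \<open>X\<close>, cross the cutvertex, and run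
  through \<open>vs\<close> ending at \<open>y\<close>. Only edges at the cutvertex are omitted, so
  a new row traversed along this path uses every edge needed later.\<close>

lemma bowtie_hamiltonian_path:
  assumes "us \<noteq> []" "vs \<noteq> []" "distinct (c # us @ vs)" "X \<in> {hd us, last us}" "y \<in> {hd vs, last vs}"
  obtains \<rho> where "\<rho> \<noteq> []" "hd \<rho> = X" "last \<rho> = y" "distinct \<rho>" "set \<rho> = set (c # us @ vs)"
    "links \<rho> \<subseteq> bowtie c us vs" "links us \<union> links vs \<subseteq> links \<rho>"
proof -
  define us' where "us' = (if X = hd us then us else rev us)"
  define vs' where "vs' = (if y = last vs then vs else rev vs)"
  have us': "us' \<noteq> []" "hd us' = X" "last us' \<in> {hd us, last us}" "links us' = links us"
      "set us' = set us" "distinct us'"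
    using assms by (auto simp: us'_def hd_rev last_rev)
  have vs': "vs' \<noteq> []" "last vs' = y" "hd vs' \<in> {hd vs, last vs}" "links vs' = links vs"
      "set vs' = set vs" "distinct vs'"
    using assms by (auto simp: vs'_def hd_rev last_rev)
  have links: "links (us' @ c # vs')
      = links us \<union> {(last us', c), (c, last us'), (c, hd vs'), (hd vs', c)} \<union> links vs"
    using us' vs' by (auto simp: links_append links_Cons)
  show ?thesis
  proof (rule that[of "us' @ c # vs'"])
    show "links (us' @ c # vs') \<subseteq> bowtie c us vs"
      using us'(3) vs'(3) assms(1,2) unfolding links bowtie_def by (auto simp: links_closed_path)
  qed (use us' vs' assms links in auto)
qed

text \<open>The edge may occur in \<open>us\<close> in either order, so the new list is described by
  its properties. Fixing both ends keeps the neighbours of the cutvertex.\<close>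

definition subdivided :: "'a \<Rightarrow> 'a \<Rightarrow> 'a \<Rightarrow> 'a \<Rightarrow> 'a list \<Rightarrow> 'a list \<Rightarrow> bool" where
  "subdivided w a b w' us us' \<longleftrightarrow> us' \<noteq> [] \<and> set us' = insert a (insert b (set us)) \<and> distinct us'
    \<and> hd us' = hd us \<and> last us' = last us \<and> length us' = length us + 2
    \<and> links us - {(w, w'), (w', w)} \<subseteq> links us' \<and> links [w, a, b, w'] \<subseteq> links us'"

lemma subdivided_exists:
  assumes "(w, w') \<in> links us" "distinct us" "a \<notin> set us" "b \<notin> set us" "a \<noteq> b"
  obtains us' where "subdivided w a b w' us us'"
proof -
  obtain ys zs where "us = ys @ w # w' # zs \<or> us = ys @ w' # w # zs"
    using links_split[OF assms(1)] .
  then show ?thesis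
  proof
    assume us: "us = ys @ w # w' # zs"
    have "subdivided w a b w' us (ys @ w # a # b # w' # zs)"
      using assms unfolding subdivided_def us
      by (cases "ys = []") (auto simp: links_append hd_append)
    then show ?thesis by (rule that)
  next
    assume us: "us = ys @ w' # w # zs"
    have "subdivided w a b w' us (ys @ w' # b # a # w # zs)"
      using assms unfolding subdivided_def us
      by (cases "ys = []") (auto simp: links_append hd_append)
    then show ?thesis by (rule that)
  qed
qed

text \<open>The invariant of the construction. The edge \<open>w w'\<close> may lie on either cycle,
  while \<open>X\<close> always belongs to \<open>us\<close> and \<open>y1\<close>,
  \<open>y2\<close> to \<open>vs\<close>. That \<open>y1\<close> and \<open>y2\<close> differ
  follows from the distinctness of \<open>xs\<close>.\<close>

definition ready where
  "ready c us vs xs X y1 y2 w w' R \<longleftrightarrow> us \<noteq> [] \<and> vs \<noteq> [] \<and> distinct (c # us @ vs)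
    \<and> ham_list (set (c # us @ vs)) (bowtie c us vs) xs \<and> alternating X y1 y2 w w' R xs
    \<and> X \<in> {hd us, last us} \<and> {y1, y2} \<subseteq> {hd vs, last vs}
    \<and> (\<forall>z \<in> set (c # us @ vs). ((z, w), (z, w')) \<in> links xs)"

lemma ready_step:
  assumes ready: "ready c us vs xs X y1 y2 w w' R"
    and sub: "subdivided w a b w' us us' \<and> vs' = vs \<or> us' = us \<and> subdivided w a b w' vs vs'"
    and new: "a \<notin> set (c # us @ vs)" "b \<notin> set (c # us @ vs)" "a \<noteq> b"
  obtains xs' R' where "ready c us' vs' xs' X y2 y1 b w' R'"
    "\<And>g g'. {g, g'} \<inter> {w, w'} = {} \<Longrightarrow> (g, g') \<in> links us \<union> links vs \<Longrightarrow>
      \<forall>z \<in> set (c # us @ vs). ((z, g), (z, g')) \<in> links xs \<Longrightarrow>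
      \<forall>z \<in> set (c # us' @ vs'). ((z, g), (z, g')) \<in> links xs'"
    "\<And>X' y y' g g'. {g, g'} \<inter> {w, w'} = {} \<Longrightarrow> alternating_in X' y y' g g' R \<Longrightarrow>
      alternating_in X' y y' g g' R'"
proof -
  have r: "us \<noteq> []" "vs \<noteq> []" "distinct (c # us @ vs)"
    "ham_list (set (c # us @ vs)) (bowtie c us vs) xs" "alternating X y1 y2 w w' R xs"
    "X \<in> {hd us, last us}" "{y1, y2} \<subseteq> {hd vs, last vs}"
    "\<forall>z \<in> set (c # us @ vs). ((z, w), (z, w')) \<in> links xs"
    using ready by (auto simp: ready_def)
  have s: "us' \<noteq> []" "vs' \<noteq> []" "distinct (c # us' @ vs')" "hd us' = hd us" "last us' = last us"
    "hd vs' = hd vs" "last vs' = last vs"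
    using sub r(1-3) new by (auto simp: subdivided_def)
  have set': "set (c # us' @ vs') = insert a (insert b (set (c # us @ vs)))"
    using sub by (auto simp: subdivided_def)
  have old: "links us \<union> links vs - {(w, w'), (w', w)} \<subseteq> links us' \<union> links vs'"
    and nw: "links [w, a, b, w'] \<subseteq> links us' \<union> links vs'"
    using sub unfolding subdivided_def by blast+
  have E': "bowtie c us vs - {(w, w'), (w', w)} \<union> links [w, a, b, w'] \<subseteq> bowtie c us' vs'"
  proof -
    \<comment> \<open>The edges at the cutvertex, shared by both bowties because the ends of the
      lists are unchanged.\<close>
    define K where "K = {(c, hd us), (hd us, c), (c, last us), (last us, c)}
      \<union> {(c, hd vs), (hd vs, c), (c, last vs), (last vs, c)}"
    have "bowtie c us vs = K \<union> (links us \<union> links vs)"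
      unfolding bowtie_def K_def links_closed_path[OF r(1)] links_closed_path[OF r(2)] by (simp only: Un_ac)
    moreover have "bowtie c us' vs' = K \<union> (links us' \<union> links vs')"
      unfolding bowtie_def K_def links_closed_path[OF s(1)] links_closed_path[OF s(2)] s(4-7)
      by (simp only: Un_ac)
    ultimately show ?thesis
      using old nw by blast
  qed
  have Xy: "X \<in> {hd us', last us'}" "y2 \<in> {hd vs', last vs'}"
    using r(6,7) s by auto
  obtain \<rho> where \<rho>: "\<rho> \<noteq> []" "hd \<rho> = X" "last \<rho> = y2" "distinct \<rho>" "set \<rho> = set (c # us' @ vs')"
    "links \<rho> \<subseteq> bowtie c us' vs'" "links us' \<union> links vs' \<subseteq> links \<rho>"
    using bowtie_hamiltonian_path[OF s(1-3) Xy] .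
  have nw': "(b, w') \<in> links \<rho>"
    using nw \<rho>(7) by auto
  obtain xs' R' where x: "ham_list (set (c # us' @ vs')) (bowtie c us' vs') xs'"
    "alternating X y2 y1 b w' R' xs'"
    "\<And>z. z \<in> set (c # us' @ vs') \<Longrightarrow> ((z, b), (z, w')) \<in> links xs'"
    "\<And>z g g'. {g, g'} \<inter> {w, w'} = {} \<Longrightarrow> (g, g') \<in> links \<rho> \<Longrightarrow> z \<in> set (c # us' @ vs') \<Longrightarrow>
      z \<in> set (c # us @ vs) \<longrightarrow> ((z, g), (z, g')) \<in> links xs \<Longrightarrow> ((z, g), (z, g')) \<in> links xs'"
    "\<And>X' y y' g g'. {g, g'} \<inter> {w, w'} = {} \<Longrightarrow> alternating_in X' y y' g g' R \<Longrightarrow>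
      alternating_in X' y y' g g' R'"
    by (rule ham_list_step[OF r(4,5,8) new E' \<rho>(1-4) \<rho>(5)[unfolded set'] \<rho>(6) nw', folded set']) (rule that)
  show ?thesis
  proof (rule that)
    show "ready c us' vs' xs' X y2 y1 b w' R'"
      unfolding ready_def using s x(1-3) r(6,7) by auto
  next
    fix g g'
    assume gg: "{g, g'} \<inter> {w, w'} = {}" "(g, g') \<in> links us \<union> links vs"
      "\<forall>z \<in> set (c # us @ vs). ((z, g), (z, g')) \<in> links xs"
    then have "(g, g') \<in> links \<rho>"
      using old \<rho>(7) by blast
    then show "\<forall>z \<in> set (c # us' @ vs'). ((z, g), (z, g')) \<in> links xs'"
      using x(4) gg(1,3) by blast
  next
    fix X' y y' g g'
    assume "{g, g'} \<inter> {w, w'} = {}" "alternating_in X' y y' g g' R"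
    then show "alternating_in X' y y' g g' R'"
      by (rule x(5))
  qed
qed

definition extendable where
  "extendable c us vs \<longleftrightarrow> (\<exists>xs X y1 y2 w w' R. ready c us vs xs X y1 y2 w w' R \<and> (w, w') \<in> links vs)"

text \<open>The configuration at the front lengthens the cycle through \<open>us\<close>; the one
  stored in \<open>R\<close> waits for the cycle through \<open>vs\<close>.\<close>

definition doubly_extendable where
  "doubly_extendable c us vs \<longleftrightarrow> (\<exists>xs X y1 y2 w w' R X' y y' g g'.
    ready c us vs xs X y1 y2 w w' R \<and> (w, w') \<in> links us \<and> (g, g') \<in> links vs
    \<and> alternating_in X' y y' g g' R \<and> X' \<in> {hd us, last us} \<and> {y, y'} \<subseteq> {hd vs, last vs}
    \<and> (\<forall>z \<in> set (c # us @ vs). ((z, g), (z, g')) \<in> links xs))"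

section \<open>Lengthening one cycle by two fresh vertices\<close>

lemma ex_two_new:
  assumes "finite (A :: 'a set)" "infinite (UNIV :: 'a set)"
  obtains a b where "a \<notin> A" "b \<notin> A" "a \<noteq> b"
proof -
  obtain a where a: "a \<notin> A"
    using ex_new_if_finite[OF assms(2,1)] by blast
  obtain b where b: "b \<notin> insert a A"
    using ex_new_if_finite[OF assms(2), of "insert a A"] assms(1) by blast
  show ?thesis
    using a b by (intro that[of a b]) auto
qed

lemma extendable_step:
  fixes vs :: "nat list"
  assumes "extendable c us vs"
  obtains vs' where "extendable c us vs'" "length vs' = length vs + 2"
proof -
  obtain xs X y1 y2 w w' R where r: "ready c us vs xs X y1 y2 w w' R" and ww: "(w, w') \<in> links vs"
    using assms by (auto simp: extendable_def)
  obtain a b where ab: "a \<notin> set (c # us @ vs)" "b \<notin> set (c # us @ vs)" "a \<noteq> b"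
    using ex_two_new[of "set (c # us @ vs)"] by auto
  have "distinct vs"
    using r by (simp add: ready_def)
  then obtain vs' where vs': "subdivided w a b w' vs vs'"
    using subdivided_exists[OF ww] ab by auto
  then have "subdivided w a b w' us us \<and> vs' = vs \<or> us = us \<and> subdivided w a b w' vs vs'"
    by simp
  then obtain xs' R' where "ready c us vs' xs' X y2 y1 b w' R'"
    by (rule ready_step[OF r _ ab])
  moreover have "(b, w') \<in> links vs'" "length vs' = length vs + 2"
    using vs' by (auto simp: subdivided_def)
  ultimately show ?thesis
    by (intro that[of vs']) (unfold extendable_def, blast+)
qed

lemma doubly_extendable_step:
  fixes us :: "nat list"
  assumes "doubly_extendable c us vs"
  obtains us' where "doubly_extendable c us' vs" "length us' = length us + 2"
proof -
  obtain xs X y1 y2 w w' R X' y y' g g' where r: "ready c us vs xs X y1 y2 w w' R"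
    and ww: "(w, w') \<in> links us" and gg: "(g, g') \<in> links vs"
    and f: "alternating_in X' y y' g g' R" "X' \<in> {hd us, last us}" "{y, y'} \<subseteq> {hd vs, last vs}"
      "\<forall>z \<in> set (c # us @ vs). ((z, g), (z, g')) \<in> links xs"
    using assms unfolding doubly_extendable_def by (elim exE conjE) (rule that)
  obtain a b where ab: "a \<notin> set (c # us @ vs)" "b \<notin> set (c # us @ vs)" "a \<noteq> b"
    using ex_two_new[of "set (c # us @ vs)"] by auto
  have d: "distinct (c # us @ vs)"
    using r by (simp add: ready_def)
  then obtain us' where us': "subdivided w a b w' us us'"
    using subdivided_exists[OF ww] ab by auto
  have disj: "{g, g'} \<inter> {w, w'} = {}"
    using links_set[OF ww] links_set[OF gg] d by auto
  have "(g, g') \<in> links us \<union> links vs"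
    using gg by simp
  note gg' = disj this f(4)
  have "subdivided w a b w' us us' \<and> vs = vs \<or> us' = us \<and> subdivided w a b w' vs vs"
    using us' by simp
  then obtain xs' R' where r': "ready c us' vs xs' X y2 y1 b w' R'"
    and keep: "\<And>g g'. {g, g'} \<inter> {w, w'} = {} \<Longrightarrow> (g, g') \<in> links us \<union> links vs \<Longrightarrow>
      \<forall>z \<in> set (c # us @ vs). ((z, g), (z, g')) \<in> links xs \<Longrightarrow>
      \<forall>z \<in> set (c # us' @ vs). ((z, g), (z, g')) \<in> links xs'"
    and alt: "\<And>X' y y' g g'. {g, g'} \<inter> {w, w'} = {} \<Longrightarrow> alternating_in X' y y' g g' R \<Longrightarrow>
      alternating_in X' y y' g g' R'"
    by (rule ready_step[OF r _ ab]) (rule that)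
  have us: "(b, w') \<in> links us'" "length us' = length us + 2" "X' \<in> {hd us', last us'}"
    using us' f(2) by (auto simp: subdivided_def)
  have "doubly_extendable c us' vs"
    unfolding doubly_extendable_def
    using r' us(1,3) gg f(3) keep[OF gg'] alt[OF disj f(1)] by blast
  then show ?thesis
    using us(2) by (rule that)
qed

text \<open>Rotating the cycle brings the stored configuration to the front; whatever preceded it
  joins the remainder.\<close>

lemma doubly_extendable_imp_extendable:
  assumes "doubly_extendable c us vs"
  shows "extendable c us vs"
proof -
  obtain xs X y1 y2 w w' R X' y y' g g' where r: "ready c us vs xs X y1 y2 w w' R"
    and gg: "(g, g') \<in> links vs"
    and f: "alternating_in X' y y' g g' R" "X' \<in> {hd us, last us}" "{y, y'} \<subseteq> {hd vs, last vs}"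
      "\<forall>z \<in> set (c # us @ vs). ((z, g), (z, g')) \<in> links xs"
    using assms unfolding doubly_extendable_def by (elim exE conjE) (rule that)
  obtain As Bs where R: "R = As @ Bs" and Bs: "\<exists>R'. alternating X' y y' g g' R' Bs"
    using f(1) by (auto simp: alternating_in_def)
  obtain As' where xs: "xs = As' @ Bs"
    using r R by (force simp: ready_def alternating_def)
  obtain R' where alt: "alternating X' y y' g g' R' (Bs @ As')"
    using Bs by (fastforce simp: alternating_def)
  have "ham_list (set (c # us @ vs)) (bowtie c us vs) (As' @ Bs)"
    using r by (simp only: ready_def xs)
  then have "ham_list (set (c # us @ vs)) (bowtie c us vs) (Bs @ As')"
    using sym_bowtie by (rule ham_list_rotate)
  \<comment> \<open>The rotation breaks only the step into \<open>(X', g')\<close>, so at most the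
    row of \<open>X'\<close> could lose its step along \<open>g g'\<close>. That row has this step
    at the very front of \<open>Bs\<close>.\<close>
  moreover have "((z, g), (z, g')) \<in> links (Bs @ As')" if z: "z \<in> set (c # us @ vs)" for z
  proof (cases "z = X'")
    case True
    then show ?thesis
      using alt by (auto simp: alternating_def)
  next
    case False
    have "hd Bs = (X', g')" "Bs \<noteq> []"
      using Bs by (auto simp: alternating_def)
    then have "((z, g), (z, g')) \<in> links As' \<union> links Bs"
      using f(4) z False links_append[of As' Bs] unfolding xs by (cases "As' = []") auto
    then show ?thesis
      using links_append_subset[of Bs As'] by blast
  qed
  ultimately have "ready c us vs (Bs @ As') X' y y' g g' R'"
    using r f(2,3) alt unfolding ready_def by blast
  then show ?thesis
    using gg unfolding extendable_def by blast
qed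

section \<open>The base case BF(3,4) and the induction\<close>

lemma doubly_extendable_base: "doubly_extendable (3 :: nat) [1, 2] [4, 5, 6]"
proof -
  \<comment> \<open>\<open>xs\<close> is a Hamiltonian cycle on 36 vertices, split right after the
    configuration for the edge \<open>1 2\<close> with rows 2, 6, 4. The remainder \<open>R\<close>
    opens with the configuration for the edge \<open>5 4\<close> with rows 1, 4, 6.\<close>
  define R :: "(nat \<times> nat) list" where "R = [(1, 4), (1, 5), (5, 1), (5, 2), (5, 3), (5, 6), (5, 5),
    (5, 4), (4, 5), (4, 4), (4, 3), (4, 6), (6, 4), (6, 5), (6, 6), (6, 3), (3, 6), (3, 5), (3, 4),
    (3, 3), (3, 1), (3, 2), (2, 3)]"
  define xs :: "(nat \<times> nat) list" where "xs = [(2, 2), (2, 1), (1, 2), (1, 1), (1, 3), (1, 6), (6, 1),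
    (6, 2), (2, 6), (2, 5), (2, 4), (4, 2), (4, 1)] @ R"
  let ?V = "set (3 # [1, 2] @ [4, 5, 6]) :: nat set"
  have alt1: "alternating 2 6 4 1 2 R xs"
    unfolding alternating_def xs_def
    by (intro exI[of _ "[(1, 2), (1, 1), (1, 3), (1, 6)]"] exI[of _ "[(2, 6), (2, 5), (2, 4)]"]) simp
  have alt2: "alternating 1 4 6 5 4 [(6, 6), (6, 3), (3, 6), (3, 5), (3, 4), (3, 3), (3, 1), (3, 2), (2, 3)] R"
    unfolding alternating_def R_def
    by (intro exI[of _ "[(5, 1), (5, 2), (5, 3), (5, 6), (5, 5), (5, 4)]"] exI[of _ "[(4, 3), (4, 6)]"]) simp
  have "set xs = ?V \<times> ?V"
    unfolding xs_def R_def by auto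
  then have ham: "ham_list ?V (bowtie 3 [1, 2] [4, 5, 6]) xs"
    by (simp add: ham_list_def xs_def R_def bowtie_def otis_rel_iff)
  have rows: "\<forall>z \<in> ?V. ((z, 1), (z, 2)) \<in> links xs" "\<forall>z \<in> ?V. ((z, 5), (z, 4)) \<in> links xs"
    by (simp_all add: xs_def R_def)
  have "ready 3 [1, 2] [4, 5, 6] xs 2 6 4 1 2 R"
    unfolding ready_def by (intro conjI alt1 ham rows) simp_all
  moreover have "alternating_in 1 4 6 5 4 R"
    unfolding alternating_in_def using alt2 append_Nil[symmetric] by blast
  moreover have "(1, 2) \<in> links [1, 2 :: nat]" "(5, 4) \<in> links [4, 5, 6 :: nat]"
    "(1 :: nat) \<in> {hd [1, 2], last [1, 2]}" "{4, 6 :: nat} \<subseteq> {hd [4, 5, 6], last [4, 5, 6]}"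
    by simp_all
  ultimately show ?thesis
    unfolding doubly_extendable_def using rows(2) by blast
qed

text \<open>First \<open>us\<close> grows from length 2 with \<open>vs\<close> fixed, carrying the
  stored configuration along. Then that configuration is brought to the front and \<open>vs\<close>
  grows from length 3.\<close>

lemma bowtie_ham_list:
  assumes "m \<ge> 1" "k \<ge> 2"
  obtains c :: nat and us vs xs where "length us = 2 * m" "length vs = 2 * k - 1"
    "distinct (c # us @ vs)" "ham_list (set (c # us @ vs)) (bowtie c us vs) xs"
proof -
  have "\<exists>us. doubly_extendable (3 :: nat) us [4, 5, 6] \<and> length us = 2 * m"
    using assms(1)
  proof (induction m rule: dec_induct)
    case base
    show ?case
      using doubly_extendable_base by (intro exI[of _ "[1, 2]"]) simp
  next
    case (step n)
    then show ?case
      by (metis doubly_extendable_step mult_Suc_right add.commute)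
  qed
  then obtain us where "doubly_extendable (3 :: nat) us [4, 5, 6]" "length us = 2 * m"
    by (elim exE conjE)
  then have us: "extendable (3 :: nat) us [4, 5, 6]" "length us = 2 * m"
    by (simp_all only: doubly_extendable_imp_extendable)
  have "\<exists>vs. extendable 3 us vs \<and> length vs = 2 * k - 1"
    using assms(2)
  proof (induction k rule: dec_induct)
    case base
    show ?case
      using us by (intro exI[of _ "[4, 5, 6]"]) simp
  next
    case (step n)
    then obtain vs where vs: "extendable 3 us vs" "length vs = 2 * n - 1"
      by (elim exE conjE)
    obtain vs' where "extendable 3 us vs'" "length vs' = length vs + 2"
      using vs(1) by (rule extendable_step)
    then show ?case
      using vs(2) step.hyps by (intro exI[of _ vs']) simp
  qed
  then obtain vs where vs: "extendable 3 us vs" "length vs = 2 * k - 1"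
    by (elim exE conjE)
  from vs(1) obtain xs where "distinct (3 # us @ vs)" "ham_list (set (3 # us @ vs)) (bowtie 3 us vs) xs"
    unfolding extendable_def ready_def by (elim exE conjE) (rule that)
  with us(2) vs(2) show ?thesis
    by (rule that)
qed

section \<open>Transfer to the graphs of the statement\<close>

text \<open>Injectivity serves twice: it keeps the list distinct, and it keeps the two coordinates
  of a transposed vertex different.\<close>

lemma ham_list_map:
  assumes "ham_list V E xs" "inj_on g V" "map_prod g g ` E \<subseteq> E'"
  shows "ham_list (g ` V) E' (map (map_prod g g) xs)"
proof -
  let ?g = "map_prod g g"
  have xs: "xs \<noteq> []" "distinct xs" "set xs = V \<times> V" "links xs \<subseteq> otis_rel E"
    "(last xs, hd xs) \<in> otis_rel E"
    using assms(1) by (auto simp: ham_list_def)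
  have step: "(?g p, ?g q) \<in> otis_rel E'" if "(p, q) \<in> otis_rel E" "p \<in> V \<times> V" for p q
    using that assms(2,3) by (fastforce simp: otis_rel_def inj_on_def)
  have "distinct (map ?g xs)"
    using xs(2,3) assms(2) by (auto simp: distinct_map inj_on_def)
  moreover have "set (map ?g xs) = g ` V \<times> g ` V"
    using xs(3) by (auto simp: image_iff)
  moreover have "links (map ?g xs) \<subseteq> otis_rel E'"
    using xs(3,4) step links_set[of _ _ xs] unfolding links_map by fastforce
  moreover have "(last (map ?g xs), hd (map ?g xs)) \<in> otis_rel E'"
    using xs(1,3,5) step last_in_set[of xs] by (auto simp: last_map hd_map)
  ultimately show ?thesis
    using xs(1) by (simp add: ham_list_def)
qed

section \<open>From a cyclic list of vertices to a cycle of arcs\<close>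

lemma pcas_zip: "pcas u (zip (u # r) (r @ [z])) z"
  by (induction r arbitrary: u) auto

lemma pawalk_verts_zip: "pawalk_verts u (zip (u # r) (r @ [z])) = u # r @ [z]"
  by (induction r arbitrary: u) auto

lemma set_zip_links: "set (zip (u # r) (r @ [z])) \<subseteq> links (u # r) \<union> {(last (u # r), z)}"
proof (induction r arbitrary: u)
  case (Cons v r)
  have "set (zip (v # r) (r @ [z])) \<subseteq> links (v # r) \<union> {(last (v # r), z)}"
    by (rule Cons)
  moreover have "set (zip (u # v # r) ((v # r) @ [z])) = insert (u, v) (set (zip (v # r) (r @ [z])))"
    by simp
  ultimately show ?case
    by auto
qed auto

lemma hamiltonian_OTIS:
  assumes "ham_list (pverts G) (parcs G) xs" "length xs \<ge> 3"
  shows "hamiltonian (OTIS G)"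
proof -
  obtain u r where xs: "xs = u # r"
    using assms(2) by (cases xs) auto
  \<comment> \<open>Each vertex is paired with its cyclic successor. The vertex sequence of this
    walk is \<open>u # r @ [u]\<close>, whose tail is a rotation of the distinct list.\<close>
  define p where "p = zip (u # r) (r @ [u])"
  have h: "distinct (u # r)" "set (u # r) = pverts G \<times> pverts G" "links (u # r) \<subseteq> otis_rel (parcs G)"
    "(last (u # r), u) \<in> otis_rel (parcs G)"
    using assms(1) by (auto simp: ham_list_def xs)
  have fst_p: "fst ` set p = pverts G \<times> pverts G"
    using h(2) by (metis length_append_singleton length_Cons list.set_map map_fst_zip p_def)
  have "snd ` set p = set (r @ [u])"
    by (metis length_append_singleton length_Cons list.set_map map_snd_zip p_def)
  then have snd_p: "snd ` set p = pverts G \<times> pverts G"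
    using h(2) by simp
  have "set p \<subseteq> otis_rel (parcs G)"
    using set_zip_links[of u r u] h(3,4) unfolding p_def by blast
  moreover have "set p \<subseteq> (pverts G \<times> pverts G) \<times> (pverts G \<times> pverts G)"
  proof
    fix e
    assume "e \<in> set p"
    then have "fst e \<in> pverts G \<times> pverts G" "snd e \<in> pverts G \<times> pverts G"
      using fst_p snd_p by blast+
    then show "e \<in> (pverts G \<times> pverts G) \<times> (pverts G \<times> pverts G)"
      by (simp only: mem_Times_iff)
  qed
  ultimately have "set p \<subseteq> parcs (OTIS G)"
    by (fastforce simp: OTIS_def otis_rel_def)
  moreover have "u \<in> pverts (OTIS G)" "pverts (OTIS G) = pverts G \<times> pverts G"
    using h(2) by (auto simp: OTIS_def)
  moreover have "distinct (tl (pawalk_verts u p))" "pcas u p u"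
    using h(1) unfolding p_def pawalk_verts_zip by (simp_all add: pcas_zip del: zip_Cons_Cons)
  moreover have "length p \<ge> 3"
    using assms(2) by (simp add: p_def xs)
  ultimately show ?thesis
    unfolding hamiltonian_def pre_digraph.cycle_def pre_digraph.awalk_def cas_with_proj_eq
      awalk_verts_with_proj_eq with_proj_simps
    using fst_p by (intro exI[of _ p] conjI exI[of _ u]) auto
qed

section \<open>Relabelling the vertices to match BF\<close>

lemma links_upt:
  "(u, v) \<in> links [a..<b] \<Longrightarrow> a \<le> u \<and> u < b \<and> a \<le> v \<and> v < b \<and> (v = Suc u \<or> u = Suc v)"
proof (induction b)
  case (Suc b)
  show ?case
  proof (cases "a < b")
    case True
    then have "links [a..<Suc b] = links [a..<b] \<union> {(b - 1, b), (b, b - 1)}"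
      by (simp add: links_append)
    then show ?thesis
      using Suc True by auto
  qed (use Suc.prems in \<open>auto split: if_splits\<close>)
qed auto

text \<open>In the order \<open>us @ c # vs\<close> only the closing edge of each cycle can fail to
  join consecutive elements, just as in the numbering of BF.\<close>

lemma bowtie_subset_links:
  assumes "us \<noteq> []" "vs \<noteq> []"
  shows "bowtie c us vs
    \<subseteq> links (us @ c # vs) \<union> {(c, hd us), (hd us, c), (c, last vs), (last vs, c)}"
  using assms by (auto simp: bowtie_def links_closed_path links_append links_Cons)

lemma path_arcs_BF:
  assumes "1 \<le> i" "Suc i < p + q"
  shows "(i, Suc i) \<in> parcs (BF p q) \<and> (Suc i, i) \<in> parcs (BF p q)"
  using assms by (cases "i < p") (auto simp: BF_def cycle_edges_def Let_def)

lemma relabel_bowtie: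
  assumes "length us = p - 1" "length vs = q - 1" "p \<ge> 2" "q \<ge> 2" "distinct (c # us @ vs)"
  obtains g where "inj_on g (set (c # us @ vs))" "g ` set (c # us @ vs) = pverts (BF p q)"
    "map_prod g g ` bowtie c us vs \<subseteq> parcs (BF p q)"
proof -
  \<comment> \<open>The new label of a vertex is its position here counted from 1, so the cutvertex,
    preceded by \<open>p - 1\<close> vertices, is labelled \<open>p\<close>.\<close>
  define ls where "ls = us @ c # vs"
  define g where "g x = the (map_of (zip ls [1..<p + q]) x)" for x
  have len: "length ls = p + q - 1"
    using assms by (simp add: ls_def)
  have ne: "us \<noteq> []" "vs \<noteq> []"
    using assms by auto
  have "distinct ls"
    using assms(5) by (auto simp: ls_def)
  then have g: "map g ls = [1..<p + q]"
    using len by (intro nth_equalityI) (auto simp: g_def map_of_zip_nth)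
  have ls: "set (c # us @ vs) = set ls"
    by (auto simp: ls_def)
  have g_nth: "g (ls ! i) = Suc i" if "i < p + q - 1" for i
    using that arg_cong[OF g, of "\<lambda>xs. xs ! i"] len by (simp add: nth_map del: upt_Suc)
  have g_c: "g c = p"
    using g_nth[of "p - 1"] assms by (simp add: ls_def nth_append)
  have g_us: "g (hd us) = 1"
    using g_nth[of 0] assms ne by (simp add: ls_def nth_append hd_conv_nth)
  have g_vs: "g (last vs) = p + q - 1"
  proof -
    have "last vs = ls ! (p + q - 2)"
      using len ne(2) last_conv_nth[of ls] by (simp add: ls_def numeral_2_eq_2)
    then show ?thesis
      using g_nth[of "p + q - 2"] assms by simp
  qed
  have "map_prod g g ` links ls \<subseteq> parcs (BF p q)"
  proof -
    have "(i, j) \<in> parcs (BF p q)" if "(i, j) \<in> links [1..<p + q]" for i j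
      using links_upt[OF that] path_arcs_BF[of i p q] path_arcs_BF[of j p q] by blast
    then have "links [1..<p + q] \<subseteq> parcs (BF p q)"
      by (rule subrelI)
    then show ?thesis
      by (simp only: links_map[symmetric] g)
  qed
  moreover have "map_prod g g ` {(c, hd us), (hd us, c), (c, last vs), (last vs, c)} \<subseteq> parcs (BF p q)"
    unfolding image_insert map_prod_simp image_empty g_c g_us g_vs
    by (simp add: BF_def cycle_edges_def Let_def)
  ultimately have arcs: "map_prod g g ` bowtie c us vs \<subseteq> parcs (BF p q)"
    using image_mono[OF bowtie_subset_links[OF ne, of c], of "map_prod g g"]
    unfolding ls_def image_Un by (meson Un_least order_trans)
  have "distinct (map g ls)"
    by (simp only: g distinct_upt)
  then have "inj_on g (set (c # us @ vs))"
    unfolding ls by (simp add: distinct_map)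
  moreover have "{1..<p + q} = {1..p + q - 1}"
    by auto
  then have "g ` set (c # us @ vs) = pverts (BF p q)"
    unfolding ls set_map[symmetric] g set_upt by (simp add: BF_def)
  ultimately show ?thesis
    using arcs by (rule that)
qed

theorem mainTheorem2:
  fixes m k :: nat
  assumes "m \<ge> 1" and "k \<ge> 2"
  shows "hamiltonian (OTIS (BF (2 * m + 1) (2 * k)))"
proof -
  let ?G = "BF (2 * m + 1) (2 * k)"
  obtain c :: nat and us vs xs where len: "length us = 2 * m" "length vs = 2 * k - 1"
    and dist: "distinct (c # us @ vs)" and xs: "ham_list (set (c # us @ vs)) (bowtie c us vs) xs"
    using bowtie_ham_list[OF assms] .
  have "length us = 2 * m + 1 - 1" "length vs = 2 * k - 1" "2 * m + 1 \<ge> 2" "2 * k \<ge> 2"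
    using len assms by auto
  then obtain g where g: "inj_on g (set (c # us @ vs))" "g ` set (c # us @ vs) = pverts ?G"
    "map_prod g g ` bowtie c us vs \<subseteq> parcs ?G"
    using dist by (rule relabel_bowtie)
  define ys where "ys = map (map_prod g g) xs"
  have ys: "ham_list (pverts ?G) (parcs ?G) ys"
    using ham_list_map[OF xs g(1,3)] unfolding g(2) ys_def .
  have "3 \<le> 2 * m + 2 * k"
    using assms by simp
  also have "\<dots> \<le> (2 * m + 2 * k) * (2 * m + 2 * k)"
    by (rule le_square)
  also have "\<dots> = card (pverts ?G \<times> pverts ?G)"
    by (simp add: BF_def card_cartesian_product)
  also have "\<dots> = length ys"
    using ys by (metis distinct_card ham_list_def)
  finally have "length ys \<ge> 3" .
  with ys show ?thesis
    by (rule hamiltonian_OTIS)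
qed

end
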